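(* Let $k\geq 1$ be an integer. For every graph $G$ with minimum degree $\delta(G)\geq k$ and maximum degree $\Delta(G)$, $$\gamma^{t}_{kS}(G) \geq |V(G)|\cdot\frac{\delta(G)-\Delta(G)+2k+2-I_{\delta(G)}-I_{\Delta(G)}}{\delta(G)+\Delta(G)+I_{\Delta(G)}-I_{\delta(G)}}\;.$$
   Context: All graphs are finite, simple and undirected, with nonempty vertex set. For each integer $n$, $I_n=1$ if $n\equiv k\pmod 2$, and $I_n=0$ otherwise. For a vertex $v$ of $G$, $N_G(v)$ denotes the open neighborhood of $v$ (the set of vertices adjacent to $v$). For $G$ of minimum degree at least $k$, a function $f:V(G)\rightarrow\{-1,1\}$ is a signed total $k$-dominating function of $G$ if $\sum_{u\in N_G(v)}f(u)\geq k$ for all $v\in V(G)$. The signed total $k$-domination number $\gamma^{t}_{kS}(G)$ is the minimum of $\sum_{v\in V(G)}f(v)$ over all signed total $k$-dominating functions $f$ of $G$. *)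

theory Defs
  imports Complex_Main "HOL-Number_Theory.Cong"
begin

locale fin_simple_graph =
  fixes V :: "'a set" and E :: "'a set set"
  assumes finite_V: "finite V"
    and V_nonempty: "V \<noteq> {}"
    and edges: "e \<in> E \<Longrightarrow> e \<subseteq> V \<and> card e = 2"

definition nbhd :: "'a set set \<Rightarrow> 'a \<Rightarrow> 'a set" where
  "nbhd E v = {u. {u, v} \<in> E}"

definition degree :: "'a set set \<Rightarrow> 'a \<Rightarrow> nat" where
  "degree E v = card (nbhd E v)"

definition min_degree :: "'a set \<Rightarrow> 'a set set \<Rightarrow> nat" where
  "min_degree V E = Min (degree E ` V)"

definition max_degree :: "'a set \<Rightarrow> 'a set set \<Rightarrow> nat" where
  "max_degree V E = Max (degree E ` V)"

definition signed_total_dominating ::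
    "nat \<Rightarrow> 'a set \<Rightarrow> 'a set set \<Rightarrow> ('a \<Rightarrow> int) \<Rightarrow> bool" where
  "signed_total_dominating k V E f \<longleftrightarrow>
     (\<forall>v\<in>V. f v \<in> {-1, 1}) \<and> (\<forall>v\<in>V. (\<Sum>u\<in>nbhd E v. f u) \<ge> int k)"

(* Functions are total on the type 'a and unconstrained outside V; only their values on V
   enter the weight. The set of weights is finite, lying between -card V and card V, and it is
   nonempty when k is at most the minimum degree (take f constantly 1), so Min is meaningful. *)
definition signed_total_domination_number :: "nat \<Rightarrow> 'a set \<Rightarrow> 'a set set \<Rightarrow> int" where
  "signed_total_domination_number k V E =
     Min {(\<Sum>v\<in>V. f v) | f. signed_total_dominating k V E f}"

definition parity_ind :: "nat \<Rightarrow> int \<Rightarrow> int" where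
  "parity_ind k n = (if [n = int k] (mod 2) then 1 else 0)"

end

(* Let P and M be the vertices of value 1 and -1, and count the edges between them from both
   sides. A vertex of degree d with p neighbours in P and m in M has p + m = d and p - m >= k,
   hence 2 p >= d + k and 2 m <= d - k. Rounding to the right parity, every vertex of M has at
   least (delta + k + 1 - I_delta) / 2 neighbours in P, and every vertex of P at most
   (Delta - k - 1 + I_Delta) / 2 neighbours in M. Comparing the two counts bounds card P from
   below, and the weight is 2 card P - card V. *)
theory Submission
  imports Defs
begin

context fin_simple_graph
begin

lemma nbhd_subset: "nbhd E v \<subseteq> V"
  using edges by (fastforce simp: nbhd_def)

lemma finite_nbhd: "finite (nbhd E v)"
  using finite_subset[OF nbhd_subset finite_V] .

lemma nbhd_sym: "u \<in> nbhd E v \<longleftrightarrow> v \<in> nbhd E u"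
  by (simp add: nbhd_def insert_commute)

lemma min_degree_le: "v \<in> V \<Longrightarrow> min_degree V E \<le> degree E v"
  unfolding min_degree_def using finite_V by simp

lemma degree_le_max: "v \<in> V \<Longrightarrow> degree E v \<le> max_degree V E"
  unfolding max_degree_def using finite_V by simp

lemma min_degree_le_max_degree: "min_degree V E \<le> max_degree V E"
  using V_nonempty min_degree_le degree_le_max order_trans by blast

text \<open>Both sides count the pairs \<open>(v, u)\<close> in A \<times> B with \<open>u\<close>
  adjacent to \<open>v\<close>, grouped by first or by second entry; symmetry of adjacency lets the
  two groupings agree.\<close>

lemma edges_between_count:
  assumes "A \<subseteq> V" "B \<subseteq> V"
  shows "(\<Sum>v\<in>A. card (nbhd E v \<inter> B)) = (\<Sum>v\<in>B. card (nbhd E v \<inter> A))"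
proof -
  have fin: "finite A" "finite B"
    using assms finite_V finite_subset by blast+
  have "nbhd E v \<inter> X = {u \<in> X. u \<in> nbhd E v}" for v X
    by blast
  moreover have "(\<Sum>v\<in>A. card {u \<in> B. u \<in> nbhd E v}) = (\<Sum>u\<in>B. card {v \<in> A. v \<in> nbhd E u})"
    using fin by (intro sum_multicount_gen) (auto simp: nbhd_sym)
  ultimately show ?thesis
    by simp
qed

end

text \<open>Kept general in \<open>A\<close> because it serves both a neighbourhood, to bound the
  counts at one vertex, and all of \<open>V\<close>, to express the weight.\<close>

lemma sum_signs:
  fixes f :: "'a \<Rightarrow> int"
  assumes "finite A" "\<forall>v\<in>A. f v \<in> {-1, 1}"
  shows "sum f A = int (card {v \<in> A. f v = 1}) - int (card {v \<in> A. f v = -1})"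
    and "card A = card {v \<in> A. f v = 1} + card {v \<in> A. f v = -1}"
proof -
  let ?P = "{v \<in> A. f v = 1}" and ?M = "{v \<in> A. f v = -1}"
  have A: "A = ?P \<union> ?M" "?P \<inter> ?M = {}"
    using assms(2) by auto
  have fin: "finite ?P" "finite ?M"
    using assms(1) by auto
  have "sum f A = sum f ?P + sum f ?M"
    using sum.union_disjoint[OF fin A(2)] A(1) by metis
  then show "sum f A = int (card ?P) - int (card ?M)"
    by simp
  show "card A = card ?P + card ?M"
    using card_Un_disjoint[OF fin A(2)] A(1) by metis
qed

text \<open>If \<open>n\<close> and \<open>k\<close> have different parity, then
  \<open>n + int k\<close> is odd and cannot equal the even number \<open>2 * p\<close>, so one more
  unit is gained; for equal parity the indicator cancels the added 1.\<close>

lemma parity_round_up: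
  assumes "n + int k \<le> 2 * p"
  shows "n + int k + 1 - parity_ind k n \<le> 2 * p"
  using assms unfolding parity_ind_def cong_def by (simp split: if_splits) presburger

lemma parity_round_down:
  assumes "2 * m \<le> n - int k"
  shows "2 * m \<le> n - int k - 1 + parity_ind k n"
  using assms unfolding parity_ind_def cong_def by (simp split: if_splits) presburger

context fin_simple_graph
begin

lemma signed_total_dominating_degrees:
  assumes f: "signed_total_dominating k V E f" and v: "v \<in> V"
  shows "degree E v + k \<le> 2 * card (nbhd E v \<inter> {u \<in> V. f u = 1})"
    and "2 * card (nbhd E v \<inter> {u \<in> V. f u = -1}) + k \<le> degree E v"
proof -
  have eq: "nbhd E v \<inter> {u \<in> V. f u = c} = {u \<in> nbhd E v. f u = c}" for c
    using nbhd_subset by blast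
  have sgn: "\<forall>u\<in>nbhd E v. f u \<in> {-1, 1}"
    using f nbhd_subset unfolding signed_total_dominating_def by blast
  have "int k \<le> sum f (nbhd E v)"
    using f v unfolding signed_total_dominating_def by blast
  with sum_signs[OF finite_nbhd sgn]
  show "degree E v + k \<le> 2 * card (nbhd E v \<inter> {u \<in> V. f u = 1})"
    and "2 * card (nbhd E v \<inter> {u \<in> V. f u = -1}) + k \<le> degree E v"
    unfolding eq degree_def by linarith+
qed

lemma signed_total_dominating_card_bound:
  fixes k :: nat
  defines "\<delta> \<equiv> int (min_degree V E)" and "\<Delta> \<equiv> int (max_degree V E)"
  assumes f: "signed_total_dominating k V E f"
  shows "int (card {v \<in> V. f v = -1}) * (\<delta> + int k + 1 - parity_ind k \<delta>)
      \<le> int (card {v \<in> V. f v = 1}) * (\<Delta> - int k - 1 + parity_ind k \<Delta>)"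
proof -
  let ?P = "{v \<in> V. f v = 1}" and ?M = "{v \<in> V. f v = -1}"
  \<comment> \<open>The degree of \<open>v\<close> is replaced by the minimum degree before
    rounding, so the parity of \<delta> alone matters, whatever the parity of the individual degree.
    The upper bound treats \<Delta> in the same way.\<close>
  have lower: "\<delta> + int k + 1 - parity_ind k \<delta> \<le> 2 * int (card (nbhd E v \<inter> ?P))" if "v \<in> ?M" for v
    using signed_total_dominating_degrees(1)[OF f, of v] min_degree_le[of v] that
    unfolding \<delta>_def by (intro parity_round_up) auto
  have upper: "2 * int (card (nbhd E v \<inter> ?M)) \<le> \<Delta> - int k - 1 + parity_ind k \<Delta>" if "v \<in> ?P" for v
    using signed_total_dominating_degrees(2)[OF f, of v] degree_le_max[of v] that
    unfolding \<Delta>_def by (intro parity_round_down) auto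
  have "int (card ?M) * (\<delta> + int k + 1 - parity_ind k \<delta>) \<le> (\<Sum>v\<in>?M. 2 * int (card (nbhd E v \<inter> ?P)))"
    by (intro sum_bounded_below lower)
  also have "\<dots> = 2 * int (\<Sum>v\<in>?M. card (nbhd E v \<inter> ?P))"
    by (simp add: sum_distrib_left)
  also have "\<dots> = 2 * int (\<Sum>v\<in>?P. card (nbhd E v \<inter> ?M))"
    using edges_between_count[of ?M ?P] by simp
  also have "\<dots> = (\<Sum>v\<in>?P. 2 * int (card (nbhd E v \<inter> ?M)))"
    by (simp add: sum_distrib_left)
  also have "\<dots> \<le> int (card ?P) * (\<Delta> - int k - 1 + parity_ind k \<Delta>)"
    by (intro sum_bounded_above upper)
  finally show ?thesis .
qed

text \<open>Write \<open>a\<close> and \<open>b\<close> for the factors on the left and right of the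
  card bound, and p, m for the numbers of vertices of value 1 and -1. The two factors here are a - b
  and a + b, and (p + m)(a - b) \<le> (p - m)(a + b) reduces to m a \<le> p b.\<close>

lemma signed_total_dominating_weight_bound:
  fixes k :: nat
  defines "\<delta> \<equiv> int (min_degree V E)" and "\<Delta> \<equiv> int (max_degree V E)"
  assumes f: "signed_total_dominating k V E f"
  shows "int (card V) * (\<delta> - \<Delta> + 2 * int k + 2 - parity_ind k \<delta> - parity_ind k \<Delta>)
      \<le> sum f V * (\<delta> + \<Delta> + parity_ind k \<Delta> - parity_ind k \<delta>)"
proof -
  have "\<forall>v\<in>V. f v \<in> {-1, 1}"
    using f unfolding signed_total_dominating_def by blast
  note signs = sum_signs[OF finite_V this]
  show ?thesis
    using signed_total_dominating_card_bound[OF f]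
    unfolding signs \<delta>_def \<Delta>_def by (simp add: algebra_simps)
qed

lemma signed_total_domination_number_attained:
  assumes "k \<le> min_degree V E"
  obtains f where "signed_total_dominating k V E f"
    and "signed_total_domination_number k V E = sum f V"
proof -
  let ?W = "{sum f V | f. signed_total_dominating k V E f}"
  have "?W \<subseteq> {- int (card V)..int (card V)}"
  proof clarify
    fix f assume "signed_total_dominating k V E f"
    then have "\<forall>v\<in>V. f v \<in> {-1, 1}"
      unfolding signed_total_dominating_def by blast
    from sum_signs[OF finite_V this] show "sum f V \<in> {- int (card V)..int (card V)}"
      by simp
  qed
  then have "finite ?W"
    using finite_subset by blast
  \<comment> \<open>For the constant 1 the sum over a neighbourhood is the degree, which is at least
    \<open>k\<close>.\<close>
  moreover have "signed_total_dominating k V E (\<lambda>_. 1)"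
    using assms min_degree_le unfolding signed_total_dominating_def degree_def
    by (fastforce intro: order_trans)
  then have "?W \<noteq> {}"
    by blast
  ultimately have "Min ?W \<in> ?W"
    by (rule Min_in)
  then show thesis
    using that unfolding signed_total_domination_number_def by blast
qed

end

theorem theorem6:
  fixes V :: "'a set" and E :: "'a set set" and k :: nat
  assumes "fin_simple_graph V E"
    and "k \<ge> 1"
    and "min_degree V E \<ge> k"
  shows "real_of_int (signed_total_domination_number k V E) \<ge>
    real (card V) *
      ((real (min_degree V E) - real (max_degree V E) + 2 * real k + 2
          - real_of_int (parity_ind k (int (min_degree V E)))
          - real_of_int (parity_ind k (int (max_degree V E))))
       / (real (min_degree V E) + real (max_degree V E)
          + real_of_int (parity_ind k (int (max_degree V E)))
          - real_of_int (parity_ind k (int (min_degree V E)))))"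
proof -
  interpret fin_simple_graph V E
    by (fact assms(1))
  obtain f where f: "signed_total_dominating k V E f"
    and num: "signed_total_domination_number k V E = sum f V"
    using signed_total_domination_number_attained[OF assms(3)] .
  let ?\<delta> = "int (min_degree V E)" and ?\<Delta> = "int (max_degree V E)"
  let ?N = "?\<delta> - ?\<Delta> + 2 * int k + 2 - parity_ind k ?\<delta> - parity_ind k ?\<Delta>"
  let ?D = "?\<delta> + ?\<Delta> + parity_ind k ?\<Delta> - parity_ind k ?\<delta>"
  have "0 \<le> parity_ind k ?\<Delta>" "parity_ind k ?\<delta> \<le> 1"
    by (auto simp: parity_ind_def)
  \<comment> \<open>Both degrees are at least k \<ge> 1, so their sum is at least 2, while the
    indicators lower it by at most 1.\<close>
  then have "0 < ?D"
    using assms(2,3) min_degree_le_max_degree by linarith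
  then have pos: "0 < real_of_int ?D"
    by (simp only: of_int_0_less_iff)
  have "real_of_int (int (card V) * ?N) \<le> real_of_int (sum f V * ?D)"
    using signed_total_dominating_weight_bound[OF f] by (simp only: of_int_le_iff)
  then have "real (card V) * (real_of_int ?N / real_of_int ?D) \<le> real_of_int (sum f V)"
    using pos by (simp only: of_int_mult of_int_of_nat_eq times_divide_eq_right pos_divide_le_eq)
  then show ?thesis
    unfolding num by simp
qed

end
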